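(* Let $n\in\mathbb{N}\setminus\{1\}$ and let $\Gamma_{S_n}$ be a Fuchsian Schottky group of rank $n$. Then $\Gamma_{S_n}$ contains orientation-preserving isometries of the hyperbolic plane $\mathbb{H}$ as side-pairing transformations.
   Context: $\mathbb{H}$ is the upper half-plane model of the hyperbolic plane, with boundary at infinity $\mathbb{RP}^1=\mathbb{R}\cup\{\infty\}$. Fuchsian Schottky group of rank $n$: let $D_1,\dots,D_{2n}$ be open, mutually disjoint and mutually non-tangential Euclidean half-discs in $\mathbb{H}$ with centers on the real line, such that for each $j=1,\dots,n$ the half-discs $D_j$ and $D_{j+n}$ are reflections of each other in the imaginary axis; say $D_{j+n}$ has diameter $(a_j,b_j)$ with $0<a_j<b_j$ and $D_j$ has diameter $(-b_j,-a_j)$. The sides are the geodesics $\partial D_j$ bounding these half-discs in $\mathbb{H}$; they bound the region $F_{S_n}=\mathbb{H}\setminus(D_1\cup\dots\cup D_{2n})$. For each $j=1,\dots,n$ let $S'_j\in PSL(2,\mathbb{R})$ be a transformation sending $\partial D_j$ to $\partial D_{j+n}$ and mapping the exterior of $D_j$ onto the interior of $D_{j+n}$; it is hyperbolic, with repelling fixed point inside $D_j$ and attracting fixed point inside $D_{j+n}$. The maps $S'_j$ and their inverses are the side-pairing transformations, and the group $\Gamma_{S_n}=\langle S'_1,\dots,S'_n\rangle\subset PSL(2,\mathbb{R})$ is called the Fuchsian Schottky group of rank $n$. *)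

theory Defs
  imports "HOL-Analysis.Analysis" "HOL-Algebra.Generated_Groups"
begin

section \<open>The group PSL(2,R) and its action by Moebius transformations\<close>

definition SL2R :: "(real^2^2) monoid" where
  "SL2R = \<lparr>carrier = {A. det A = 1}, mult = (**), one = mat 1\<rparr>"

definition PSL2R :: "(real^2^2) set monoid" where
  "PSL2R = SL2R Mod {mat 1, - mat 1}"

definition moebius_mat :: "real^2^2 \<Rightarrow> complex \<Rightarrow> complex" where
  "moebius_mat A z =
     (complex_of_real (A$1$1) * z + complex_of_real (A$1$2)) /
     (complex_of_real (A$2$1) * z + complex_of_real (A$2$2))"

text \<open>Elements of PSL(2,R) are cosets, here $\{A,-A\}$; both representatives induce the same
  transformation (see lemma \<open>psl_act_coset\<close>).\<close>

definition psl_act :: "(real^2^2) set \<Rightarrow> complex \<Rightarrow> complex" where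
  "psl_act X z = the_elem ((\<lambda>A. moebius_mat A z) ` X)"

lemma group_SL2R: "group SL2R"
proof (rule groupI)
  fix A assume A: "A \<in> carrier SL2R"
  have "invertible A"
    using A by (simp add: SL2R_def invertible_det_nz)
  then obtain B where B: "B ** A = mat 1"
    by (auto simp: invertible_def)
  have "det B * det A = 1"
    by (metis B det_I det_mul)
  then show "\<exists>B\<in>carrier SL2R. B \<otimes>\<^bsub>SL2R\<^esub> A = \<one>\<^bsub>SL2R\<^esub>"
    using A B by (auto simp: SL2R_def)
qed (auto simp: SL2R_def det_mul matrix_mul_assoc)

lemma matrix_mul_uminus_left: "(- A) ** B = - (A ** (B :: real^2^2))"
  by (simp add: matrix_matrix_mult_def vec_eq_iff sum_negf)

lemma matrix_mul_uminus_right: "A ** (- B) = - (A ** (B :: real^2^2))"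
  by (simp add: matrix_matrix_mult_def vec_eq_iff sum_negf)

lemma normal_center_SL2R: "{mat 1, - mat 1} \<lhd> SL2R"
proof -
  interpret group SL2R by (rule group_SL2R)
  have det_neg: "det (- mat 1 :: real^2^2) = 1"
    by (simp add: det_2 mat_def)
  have neg_sq: "- mat 1 ** - mat 1 = (mat 1 :: real^2^2)"
    by (simp add: matrix_mul_uminus_left matrix_mul_uminus_right)
  have inv_neg: "inv\<^bsub>SL2R\<^esub> (- mat 1) = - mat 1"
    by (rule inv_equality) (auto simp: SL2R_def det_neg neg_sq)
  have inv_one_mat: "inv\<^bsub>SL2R\<^esub> (mat 1) = mat 1"
    using inv_one by (simp add: SL2R_def)
  have "subgroup {mat 1, - mat 1} SL2R"
  proof
    show "{mat 1, - mat 1} \<subseteq> carrier SL2R"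
      by (simp add: SL2R_def det_neg)
  next
    fix x y assume "x \<in> {mat 1, - mat 1 :: real^2^2}" "y \<in> {mat 1, - mat 1 :: real^2^2}"
    then show "x \<otimes>\<^bsub>SL2R\<^esub> y \<in> {mat 1, - mat 1}"
      by (auto simp: SL2R_def neg_sq)
  next
    show "\<one>\<^bsub>SL2R\<^esub> \<in> {mat 1, - mat 1}" by (simp add: SL2R_def)
  next
    fix x assume "x \<in> {mat 1, - mat 1 :: real^2^2}"
    then show "inv\<^bsub>SL2R\<^esub> x \<in> {mat 1, - mat 1}"
      using inv_neg inv_one_mat by auto
  qed
  then show ?thesis
    by (rule normalI)
       (auto simp: r_coset_def l_coset_def SL2R_def matrix_mul_uminus_left matrix_mul_uminus_right)
qed

lemma group_PSL2R: "group PSL2R"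
  unfolding PSL2R_def by (rule normal.factorgroup_is_group[OF normal_center_SL2R])

lemma psl_act_coset:
  "psl_act ({mat 1, - mat 1} #>\<^bsub>SL2R\<^esub> A) = moebius_mat A"
proof
  fix z
  have "moebius_mat (- A) z = moebius_mat A z"
  proof -
    have "(- p * z + - q) / (- r * z + - s) = (p * z + q) / (r * z + s)" for p q r s :: complex
      using minus_divide_divide[of "p * z + q" "r * z + s"] by simp
    then show ?thesis by (simp add: moebius_mat_def)
  qed
  moreover have "{mat 1, - mat 1} #>\<^bsub>SL2R\<^esub> A = {A, - A}"
    by (auto simp: r_coset_def SL2R_def matrix_mul_uminus_left)
  ultimately show "psl_act ({mat 1, - mat 1} #>\<^bsub>SL2R\<^esub> A) z = moebius_mat A z"
    by (simp add: psl_act_def)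
qed

section \<open>The upper half-plane model of the hyperbolic plane\<close>

definition upper_half_plane :: "complex set" ("\<H>") where
  "\<H> = {z. Im z > 0}"

text \<open>Path length with respect to $ds^2 = (dx^2 + dy^2)/y^2$. It is a relation and not a function
  because a library \<open>valid_path\<close> (continuous, and C1 off a finite set) may have a speed that is
  not integrable near an exceptional parameter; \<open>integral\<close> would assign such a path length 0.\<close>

definition has_hyp_length :: "(real \<Rightarrow> complex) \<Rightarrow> real \<Rightarrow> bool" where
  "has_hyp_length \<gamma> l \<longleftrightarrow>
     ((\<lambda>t. norm (vector_derivative \<gamma> (at t)) / Im (\<gamma> t)) has_integral l) {0..1}"

definition hyp_dist :: "complex \<Rightarrow> complex \<Rightarrow> real" where
  "hyp_dist z w = Inf {l. \<exists>\<gamma>. valid_path \<gamma> \<and> path_image \<gamma> \<subseteq> \<H> \<and>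
     pathstart \<gamma> = z \<and> pathfinish \<gamma> = w \<and> has_hyp_length \<gamma> l}"

definition hyp_isometry :: "(complex \<Rightarrow> complex) \<Rightarrow> bool" where
  "hyp_isometry f \<longleftrightarrow>
     bij_betw f \<H> \<H> \<and> (\<forall>z\<in>\<H>. \<forall>w\<in>\<H>. hyp_dist (f z) (f w) = hyp_dist z w)"

text \<open>The last condition says that the real Jacobian determinant, whose columns are
  the images of the basis vectors $1$ and $i$ under the differential, is positive.\<close>

definition orientation_preserving_on :: "complex set \<Rightarrow> (complex \<Rightarrow> complex) \<Rightarrow> bool" where
  "orientation_preserving_on U f \<longleftrightarrow>
     (\<forall>z\<in>U. \<exists>f'. (f has_derivative f') (at z) \<and>
        Re (f' 1) * Im (f' \<i>) - Re (f' \<i>) * Im (f' 1) > 0)"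

section \<open>Fuchsian Schottky groups\<close>

definition half_disc :: "real \<Rightarrow> real \<Rightarrow> complex set" where
  "half_disc x y = ball (complex_of_real ((x + y) / 2)) ((y - x) / 2) \<inter> \<H>"

text \<open>For $1 \le j \le n$ the half-discs with indices $j$ and $j+n$ have diameters
  $(-b_j,-a_j)$ and $(a_j,b_j)$.\<close>

definition schottky_disc :: "nat \<Rightarrow> (nat \<Rightarrow> real) \<Rightarrow> (nat \<Rightarrow> real) \<Rightarrow> nat \<Rightarrow> complex set" where
  "schottky_disc n a b i =
     (if i \<le> n then half_disc (- b i) (- a i) else half_disc (a (i - n)) (b (i - n)))"

lemma schottky_disc_reflection:
  assumes "1 \<le> j" "j \<le> n"
  shows "schottky_disc n a b j = (\<lambda>z. - cnj z) ` schottky_disc n a b (j + n)"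
proof -
  have *: "- cnj z \<in> half_disc (- y) (- x) \<longleftrightarrow> z \<in> half_disc x y" for x y z
  proof -
    have "dist (complex_of_real ((- y + - x) / 2)) (- cnj z) =
          norm (cnj (z - complex_of_real ((x + y) / 2)))"
      by (simp add: dist_norm field_simps)
    also have "\<dots> = dist (complex_of_real ((x + y) / 2)) z"
      by (simp only: complex_mod_cnj dist_norm norm_minus_commute)
    finally show ?thesis
      by (simp add: half_disc_def upper_half_plane_def mem_ball)
  qed
  have "half_disc (- y) (- x) = (\<lambda>z. - cnj z) ` half_disc x y" for x y
  proof (intro Set.set_eqI iffI)
    fix w assume "w \<in> half_disc (- y) (- x)"
    then have "- cnj w \<in> half_disc x y" using *[of "- cnj w" y x] by simp
    then show "w \<in> (\<lambda>z. - cnj z) ` half_disc x y"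
      by (intro image_eqI[of _ _ "- cnj w"]) auto
  qed (use * in auto)
  then show ?thesis
    using assms by (simp add: schottky_disc_def)
qed

definition schottky_side :: "nat \<Rightarrow> (nat \<Rightarrow> real) \<Rightarrow> (nat \<Rightarrow> real) \<Rightarrow> nat \<Rightarrow> complex set" where
  "schottky_side n a b i = frontier (schottky_disc n a b i) \<inter> \<H>"

definition schottky_exterior :: "nat \<Rightarrow> (nat \<Rightarrow> real) \<Rightarrow> (nat \<Rightarrow> real) \<Rightarrow> nat \<Rightarrow> complex set" where
  "schottky_exterior n a b i = \<H> - closure (schottky_disc n a b i)"

definition schottky_region :: "nat \<Rightarrow> (nat \<Rightarrow> real) \<Rightarrow> (nat \<Rightarrow> real) \<Rightarrow> complex set" where
  "schottky_region n a b = \<H> - (\<Union>i\<in>{1..2*n}. schottky_disc n a b i)"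

text \<open>Closures are taken in the complex plane: two half-discs are disjoint and non-tangential
  (which includes tangency at a point of the real axis) iff their closures are disjoint.\<close>

definition fuchsian_schottky_group ::
  "nat \<Rightarrow> (nat \<Rightarrow> real) \<Rightarrow> (nat \<Rightarrow> real) \<Rightarrow> (nat \<Rightarrow> (real^2^2) set) \<Rightarrow> (real^2^2) set set \<Rightarrow> bool"
where
  "fuchsian_schottky_group n a b S \<Gamma> \<longleftrightarrow>
     (\<forall>j\<in>{1..n}. 0 < a j \<and> a j < b j) \<and>
     (\<forall>i\<in>{1..2*n}. \<forall>k\<in>{1..2*n}. i \<noteq> k \<longrightarrow>
        closure (schottky_disc n a b i) \<inter> closure (schottky_disc n a b k) = {}) \<and>
     (\<forall>j\<in>{1..n}. S j \<in> carrier PSL2R \<and>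
        psl_act (S j) ` schottky_side n a b j = schottky_side n a b (j + n) \<and>
        psl_act (S j) ` schottky_exterior n a b j = schottky_disc n a b (j + n)) \<and>
     \<Gamma> = generate PSL2R (S ` {1..n})"

text \<open>A transformation pairs side $i$ with side $k$ if it carries the one onto the other and
  the exterior of the half-disc $i$ onto the half-disc $k$, so that the image of the
  region lies beyond side $k$ and meets the region in that side only.\<close>

definition side_pairing ::
  "nat \<Rightarrow> (nat \<Rightarrow> real) \<Rightarrow> (nat \<Rightarrow> real) \<Rightarrow> nat \<Rightarrow> nat \<Rightarrow> (complex \<Rightarrow> complex) \<Rightarrow> bool" where
  "side_pairing n a b i k f \<longleftrightarrow>
     f ` schottky_side n a b i = schottky_side n a b k \<and>
     f ` schottky_exterior n a b i = schottky_disc n a b k \<and>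
     schottky_region n a b \<inter> f ` schottky_region n a b = schottky_side n a b k"

end

theory Submission
  imports Defs
begin

text \<open>An element of $PSL(2,\mathbb{R})$ acts by $z \mapsto (pz+q)/(rz+s)$ with $ps-qr=1$. Two
  identities carry the analytic half of the theorem: the derivative is $1/(rz+s)^2$, and the
  imaginary part is divided by $|rz+s|^2$. The conformal factor of the derivative thus cancels
  against the change of height in $|dz|/\mathrm{Im}\,z$, so path lengths are preserved, and the
  inverse matrix supplies the reverse inclusion between the sets of path lengths; hence the action is
  isometric (\<open>hyp_isometry_moebius\<close>). Multiplication by a nonzero complex number has positive real
  Jacobian determinant, so orientation is preserved (\<open>orientation_preserving_moebius\<close>).

  The side-pairing half is set theory. Each half-disc $D_i$ is open, so $\mathbb{H}$ is partitioned
  into $D_i$, its side and its exterior. A bijection of $\mathbb{H}$ that takes the side and the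
  exterior of $D_i$ to the side and the interior of $D_k$ must take $D_i$ to the exterior of $D_k$,
  so its inverse satisfies the same conditions with $i$ and $k$ exchanged
  (\<open>inverse_pairs_sides\<close>). The region lies in the exterior of $D_i$ together with the side, so
  its image lies in $D_k$ together with the side of $D_k$, and meets the region in that side only
  (\<open>side_pairingI\<close>).\<close>

section \<open>Moebius transformations of the upper half-plane\<close>

lemma moebius_denom_nonzero:
  fixes A :: "real^2^2"
  assumes "det A = 1" "z \<in> \<H>"
  shows "complex_of_real (A$2$1) * z + complex_of_real (A$2$2) \<noteq> 0"
proof
  assume 0: "complex_of_real (A$2$1) * z + complex_of_real (A$2$2) = 0"
  have "A$2$1 * Im z = 0" "A$2$1 * Re z + A$2$2 = 0"
    using 0 by (auto simp: complex_eq_iff)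
  then have "A$2$1 = 0" "A$2$2 = 0"
    using assms(2) by (auto simp: upper_half_plane_def)
  then show False using assms(1) by (simp add: det_2)
qed

text \<open>Multiplying numerator and denominator by the conjugate of the denominator leaves the
  determinant as the coefficient of \<open>Im z\<close>.\<close>

lemma Im_moebius:
  assumes "det A = 1" "z \<in> \<H>"
  shows "Im (moebius_mat A z) =
    Im z / (norm (complex_of_real (A$2$1) * z + complex_of_real (A$2$2)))\<^sup>2"
proof -
  let ?d = "complex_of_real (A$2$1) * z + complex_of_real (A$2$2)"
  have det: "A$1$1 * A$2$2 = 1 + A$1$2 * A$2$1"
    using assms(1) by (simp add: det_2)
  have "Im (moebius_mat A z) =
      (A$1$1 * A$2$2 * Im z - A$1$2 * A$2$1 * Im z) / (norm ?d)\<^sup>2"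
    by (simp add: moebius_mat_def Im_divide cmod_power2 algebra_simps)
  also have "\<dots> = Im z / (norm ?d)\<^sup>2"
    unfolding det by (simp add: algebra_simps)
  finally show ?thesis .
qed

lemma moebius_in_upper_half_plane:
  assumes "det A = 1" "z \<in> \<H>"
  shows "moebius_mat A z \<in> \<H>"
  using assms(2) moebius_denom_nonzero[OF assms] Im_moebius[OF assms]
  by (simp add: upper_half_plane_def)

lemma moebius_mat_mult:
  assumes "det B = 1" "z \<in> \<H>"
  shows "moebius_mat (A ** B) z = moebius_mat A (moebius_mat B z)"
proof -
  define n d where "n = complex_of_real (B$1$1) * z + complex_of_real (B$1$2)"
    and "d = complex_of_real (B$2$1) * z + complex_of_real (B$2$2)"
  have d: "d \<noteq> 0"
    using moebius_denom_nonzero[OF assms] by (simp add: d_def)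
  have scale: "x * (n / d) + y = (x * n + y * d) / d" for x y
    using d by (simp add: field_simps)
  have "moebius_mat A (moebius_mat B z) =
      (complex_of_real (A$1$1) * n + complex_of_real (A$1$2) * d) /
      (complex_of_real (A$2$1) * n + complex_of_real (A$2$2) * d)"
    using d by (simp add: moebius_mat_def[of A] moebius_mat_def[of B] n_def[symmetric]
        d_def[symmetric] scale del: times_divide_eq_right)
  also have "\<dots> = moebius_mat (A ** B) z"
    by (simp add: moebius_mat_def matrix_matrix_mult_def sum_2 n_def d_def algebra_simps)
  finally show ?thesis ..
qed

lemma moebius_mat_one: "moebius_mat (mat 1) z = z"
  by (simp add: moebius_mat_def mat_def)

lemma moebius_mat_inverse:
  assumes "det B = 1" "A ** B = mat 1" "z \<in> \<H>"
  shows "moebius_mat A (moebius_mat B z) = z"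
  using moebius_mat_mult[OF assms(1,3), of A] assms(2) by (simp add: moebius_mat_one)

lemma bij_betw_moebius:
  assumes "det A = 1" "det B = 1" "A ** B = mat 1"
  shows "bij_betw (moebius_mat A) \<H> \<H>"
proof (rule bij_betw_byWitness[where f' = "moebius_mat B"])
  have BA: "B ** A = mat 1"
    using assms(3) matrix_left_right_inverse by blast
  show "\<forall>z\<in>\<H>. moebius_mat B (moebius_mat A z) = z"
    using moebius_mat_inverse[OF assms(1) BA] by blast
  show "\<forall>z\<in>\<H>. moebius_mat A (moebius_mat B z) = z"
    using moebius_mat_inverse[OF assms(2,3)] by blast
qed (use moebius_in_upper_half_plane assms in blast)+

lemma moebius_has_field_derivative:
  assumes "det A = 1" "z \<in> \<H>"
  shows "(moebius_mat A has_field_derivative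
    1 / (complex_of_real (A$2$1) * z + complex_of_real (A$2$2))\<^sup>2) (at z)"
proof -
  let ?p = "complex_of_real (A$1$1)" and ?q = "complex_of_real (A$1$2)"
    and ?r = "complex_of_real (A$2$1)" and ?s = "complex_of_real (A$2$2)"
  have "?p * ?s - ?q * ?r = complex_of_real (det A)"
    by (simp add: det_2)
  then have det: "?p * ?s - ?q * ?r = 1"
    using assms(1) by simp
  have "?p * (?r * z + ?s) - (?p * z + ?q) * ?r = ?p * ?s - ?q * ?r"
    by (simp add: algebra_simps)
  then have num: "?p * (?r * z + ?s) - (?p * z + ?q) * ?r = 1"
    using det by simp
  have "((\<lambda>z. (?p * z + ?q) / (?r * z + ?s)) has_field_derivative
      (?p * (?r * z + ?s) - (?p * z + ?q) * ?r) / ((?r * z + ?s) * (?r * z + ?s))) (at z)"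
    using moebius_denom_nonzero[OF assms]
    by (auto intro!: derivative_eq_intros)
  then show ?thesis
    unfolding num by (simp add: moebius_mat_def[abs_def] power2_eq_square)
qed

text \<open>The differential is multiplication by a complex number \<open>w \<noteq> 0\<close>, whose real
  determinant is \<open>(norm w)\<^sup>2\<close>.\<close>

lemma orientation_preserving_moebius:
  assumes "det A = 1"
  shows "orientation_preserving_on \<H> (moebius_mat A)"
  unfolding orientation_preserving_on_def
proof
  fix z assume z: "z \<in> \<H>"
  let ?w = "1 / (complex_of_real (A$2$1) * z + complex_of_real (A$2$2))\<^sup>2"
  have "?w \<noteq> 0"
    using moebius_denom_nonzero[OF assms z] by simp
  then have "(Re ?w)\<^sup>2 + (Im ?w)\<^sup>2 > 0"
    using complex_neq_0 by blast
  moreover have "Re (w * 1) * Im (w * \<i>) - Re (w * \<i>) * Im (w * 1) = (Re w)\<^sup>2 + (Im w)\<^sup>2"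
    for w by (simp add: power2_eq_square)
  ultimately have "Re (?w * 1) * Im (?w * \<i>) - Re (?w * \<i>) * Im (?w * 1) > 0"
    by metis
  then show "\<exists>f'. (moebius_mat A has_derivative f') (at z) \<and>
      Re (f' 1) * Im (f' \<i>) - Re (f' \<i>) * Im (f' 1) > 0"
    using moebius_has_field_derivative[OF assms z] unfolding has_field_derivative_def by blast
qed

section \<open>Invariance of the hyperbolic distance\<close>

lemma valid_path_moebius:
  assumes A: "det A = 1" and g: "valid_path \<gamma>" "path_image \<gamma> \<subseteq> \<H>"
  shows "valid_path (moebius_mat A \<circ> \<gamma>)"
proof (rule valid_path_compose[OF g(1)])
  show "moebius_mat A field_differentiable at z" if "z \<in> path_image \<gamma>" for z
    using moebius_has_field_derivative[OF A] g(2) that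
    unfolding field_differentiable_def by blast
  have "continuous_on (path_image \<gamma>)
      (\<lambda>z. 1 / (complex_of_real (A$2$1) * z + complex_of_real (A$2$2))\<^sup>2)"
    using moebius_denom_nonzero[OF A] g(2) by (intro continuous_intros) auto
  then show "continuous_on (path_image \<gamma>) (deriv (moebius_mat A))"
  proof (rule continuous_on_eq)
    fix z assume "z \<in> path_image \<gamma>"
    then have "z \<in> \<H>"
      using g(2) by blast
    then show "1 / (complex_of_real (A$2$1) * z + complex_of_real (A$2$2))\<^sup>2 =
        deriv (moebius_mat A) z"
      using DERIV_imp_deriv[OF moebius_has_field_derivative[OF A]] by simp
  qed
qed

text \<open>The speed of the image path is the speed of \<open>\<gamma>\<close> divided by the square of the modulus of the
  denominator, and so is its height; the integrands agree wherever \<open>\<gamma>\<close> is differentiable, which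
  is all but finitely many parameters.\<close>

lemma has_hyp_length_moebius:
  assumes A: "det A = 1" and g: "valid_path \<gamma>" "path_image \<gamma> \<subseteq> \<H>"
    and l: "has_hyp_length \<gamma> l"
  shows "has_hyp_length (moebius_mat A \<circ> \<gamma>) l"
proof -
  obtain X where X: "finite X" "\<gamma> C1_differentiable_on {0..1} - X"
    using g(1) unfolding valid_path_def piecewise_C1_differentiable_on_def by auto
  have same: "norm (vector_derivative (moebius_mat A \<circ> \<gamma>) (at t)) / Im ((moebius_mat A \<circ> \<gamma>) t) =
      norm (vector_derivative \<gamma> (at t)) / Im (\<gamma> t)" if t: "t \<in> {0..1} - X" for t
  proof -
    let ?d = "complex_of_real (A$2$1) * \<gamma> t + complex_of_real (A$2$2)"
    have H: "\<gamma> t \<in> \<H>"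
      using t g(2) by (auto simp: path_image_def)
    note der = moebius_has_field_derivative[OF A H]
    have "\<gamma> differentiable at t"
      using X(2) t by (meson C1_differentiable_on_eq)
    then have "vector_derivative (moebius_mat A \<circ> \<gamma>) (at t) =
        vector_derivative \<gamma> (at t) * (1 / ?d\<^sup>2)"
      using der DERIV_imp_deriv[OF der] vector_derivative_chain_at_general[of \<gamma> t "moebius_mat A"]
      unfolding field_differentiable_def by auto
    then show ?thesis
      using moebius_denom_nonzero[OF A H] Im_moebius[OF A H]
      by (simp add: norm_mult norm_divide norm_power)
  qed
  show ?thesis
    unfolding has_hyp_length_def
  proof (rule has_integral_spike_finite[OF X(1)])
    show "((\<lambda>t. norm (vector_derivative \<gamma> (at t)) / Im (\<gamma> t)) has_integral l) {0..1}"
      using l by (simp add: has_hyp_length_def)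
  qed (rule same)
qed

text \<open>The set whose infimum is the hyperbolic distance. Isometry is proved by transporting
  this set, which avoids any question of whether the infimum is attained.\<close>

definition hyp_lengths :: "complex \<Rightarrow> complex \<Rightarrow> real set" where
  "hyp_lengths z w = {l. \<exists>\<gamma>. valid_path \<gamma> \<and> path_image \<gamma> \<subseteq> \<H> \<and>
     pathstart \<gamma> = z \<and> pathfinish \<gamma> = w \<and> has_hyp_length \<gamma> l}"

lemma hyp_lengths_moebius_subset:
  assumes A: "det A = 1"
  shows "hyp_lengths z w \<subseteq> hyp_lengths (moebius_mat A z) (moebius_mat A w)"
proof
  fix l assume "l \<in> hyp_lengths z w"
  then obtain \<gamma> where g: "valid_path \<gamma>" "path_image \<gamma> \<subseteq> \<H>"
    and ends: "pathstart \<gamma> = z" "pathfinish \<gamma> = w" and l: "has_hyp_length \<gamma> l"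
    by (auto simp: hyp_lengths_def)
  have "path_image (moebius_mat A \<circ> \<gamma>) \<subseteq> \<H>"
    using g(2) moebius_in_upper_half_plane[OF A] unfolding path_image_compose by blast
  moreover have "pathstart (moebius_mat A \<circ> \<gamma>) = moebius_mat A z"
      "pathfinish (moebius_mat A \<circ> \<gamma>) = moebius_mat A w"
    using ends by (simp_all add: pathstart_compose pathfinish_compose)
  ultimately show "l \<in> hyp_lengths (moebius_mat A z) (moebius_mat A w)"
    using valid_path_moebius[OF A g] has_hyp_length_moebius[OF A g l]
    unfolding hyp_lengths_def by blast
qed

lemma hyp_isometry_moebius:
  assumes A: "det A = 1" and B: "det B = 1" and AB: "A ** B = mat 1"
  shows "hyp_isometry (moebius_mat A)"
  unfolding hyp_isometry_def
proof (intro conjI ballI)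
  show "bij_betw (moebius_mat A) \<H> \<H>"
    by (rule bij_betw_moebius[OF assms])
  fix z w assume H: "z \<in> \<H>" "w \<in> \<H>"
  have BA: "B ** A = mat 1"
    using AB matrix_left_right_inverse by blast
  have "hyp_lengths (moebius_mat A z) (moebius_mat A w) = hyp_lengths z w"
    using hyp_lengths_moebius_subset[OF A, of z w]
      hyp_lengths_moebius_subset[OF B, of "moebius_mat A z" "moebius_mat A w"]
      moebius_mat_inverse[OF A BA] H by auto
  then show "hyp_dist (moebius_mat A z) (moebius_mat A w) = hyp_dist z w"
    by (simp add: hyp_dist_def hyp_lengths_def)
qed

section \<open>Elements of PSL(2,R)\<close>

text \<open>Inversion in the quotient is inversion of a representative, so an element and its inverse
  act by a pair of mutually inverse matrices of determinant 1.\<close>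

lemma PSL2R_act_representatives:
  assumes "X \<in> carrier PSL2R"
  obtains A B where "det A = 1" "det B = 1" "A ** B = mat 1" "B ** A = mat 1"
    "psl_act X = moebius_mat A" "psl_act (inv\<^bsub>PSL2R\<^esub> X) = moebius_mat B"
proof -
  interpret SL: group SL2R by (rule group_SL2R)
  interpret N: normal "{mat 1, - mat 1}" SL2R by (rule normal_center_SL2R)
  obtain A where A: "A \<in> carrier SL2R" and X: "X = {mat 1, - mat 1} #>\<^bsub>SL2R\<^esub> A"
    using assms by (auto simp: PSL2R_def carrier_FactGroup)
  define B where "B = inv\<^bsub>SL2R\<^esub> A"
  have B: "B \<in> carrier SL2R"
    using A by (simp add: B_def)
  have "inv\<^bsub>PSL2R\<^esub> X = {mat 1, - mat 1} #>\<^bsub>SL2R\<^esub> B"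
    using assms N.inv_FactGroup[of X] N.rcos_inv[OF A] by (simp add: PSL2R_def X B_def)
  moreover have "A ** B = mat 1" "B ** A = mat 1"
    using SL.r_inv[OF A] SL.l_inv[OF A] by (simp_all add: B_def SL2R_def)
  moreover have det: "det A = 1" "det B = 1"
    using A B by (simp_all add: SL2R_def)
  ultimately show thesis
    using that[of A B] det by (simp add: X psl_act_coset)
qed

section \<open>Pairing the sides of the Schottky region\<close>

lemma open_schottky_disc: "open (schottky_disc n a b i)"
  by (auto simp: schottky_disc_def half_disc_def upper_half_plane_def
      intro!: open_Int open_halfspace_Im_gt)

lemma schottky_disc_subset: "schottky_disc n a b i \<subseteq> \<H>"
  by (auto simp: schottky_disc_def half_disc_def)

lemma schottky_side_eq:
  "schottky_side n a b i = (closure (schottky_disc n a b i) - schottky_disc n a b i) \<inter> \<H>"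
  by (simp add: schottky_side_def frontier_def interior_open[OF open_schottky_disc])

lemma schottky_disc_eq:
  "schottky_disc n a b i = \<H> - (schottky_side n a b i \<union> schottky_exterior n a b i)"
  using closure_subset[of "schottky_disc n a b i"] schottky_disc_subset[of n a b i]
  by (auto simp: schottky_side_eq schottky_exterior_def)

lemma schottky_exterior_eq:
  "schottky_exterior n a b i = \<H> - (schottky_side n a b i \<union> schottky_disc n a b i)"
  using closure_subset[of "schottky_disc n a b i"]
  by (auto simp: schottky_side_eq schottky_exterior_def)

lemma schottky_side_subset_region:
  assumes disj: "\<forall>i\<in>{1..2*n}. \<forall>k\<in>{1..2*n}. i \<noteq> k \<longrightarrow>
      closure (schottky_disc n a b i) \<inter> closure (schottky_disc n a b k) = {}"
    and i: "i \<in> {1..2*n}"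
  shows "schottky_side n a b i \<subseteq> schottky_region n a b"
proof
  fix z assume z: "z \<in> schottky_side n a b i"
  have "z \<notin> schottky_disc n a b k" if "k \<in> {1..2*n}" for k
  proof (cases "k = i")
    case False
    then show ?thesis
      using disj i that z closure_subset[of "schottky_disc n a b k"]
      by (fastforce simp: schottky_side_eq)
  qed (use z in \<open>simp add: schottky_side_eq\<close>)
  then show "z \<in> schottky_region n a b"
    using z by (auto simp: schottky_region_def schottky_side_def)
qed

text \<open>Points of the region that lie off side \<open>i\<close> are in the exterior of disc \<open>i\<close>, so they are
  sent into disc \<open>k\<close>, which the region avoids. Conversely side \<open>k\<close> belongs to the region and is
  the image of side \<open>i\<close>, which belongs to it too because the closed discs are disjoint.\<close>

lemma side_pairingI:
  assumes disj: "\<forall>i\<in>{1..2*n}. \<forall>k\<in>{1..2*n}. i \<noteq> k \<longrightarrow>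
      closure (schottky_disc n a b i) \<inter> closure (schottky_disc n a b k) = {}"
    and i: "i \<in> {1..2*n}" and k: "k \<in> {1..2*n}"
    and side: "f ` schottky_side n a b i = schottky_side n a b k"
    and ext: "f ` schottky_exterior n a b i = schottky_disc n a b k"
  shows "side_pairing n a b i k f"
proof -
  let ?R = "schottky_region n a b"
  have "?R \<subseteq> schottky_side n a b i \<union> schottky_exterior n a b i"
    using i schottky_disc_eq[of n a b i] by (auto simp: schottky_region_def)
  then have "f ` ?R \<subseteq> schottky_side n a b k \<union> schottky_disc n a b k"
    using side ext by blast
  moreover have "?R \<inter> schottky_disc n a b k = {}"
    using k by (auto simp: schottky_region_def)
  moreover have "schottky_side n a b k \<subseteq> ?R" "schottky_side n a b k \<subseteq> f ` ?R"
    using schottky_side_subset_region[OF disj i] schottky_side_subset_region[OF disj k] side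
    by blast+
  ultimately have "?R \<inter> f ` ?R = schottky_side n a b k"
    by blast
  then show ?thesis
    using side ext by (simp add: side_pairing_def)
qed

text \<open>Disc, side and exterior partition \<open>\<H>\<close> for both indices, so the bijection \<open>f\<close>, which
  already fills the side and the disc of index \<open>k\<close>, has only the exterior left as the image of
  disc \<open>i\<close>.\<close>

lemma inverse_pairs_sides:
  assumes f: "bij_betw f \<H> \<H>" and g: "\<And>z. z \<in> \<H> \<Longrightarrow> g (f z) = z"
    and side: "f ` schottky_side n a b i = schottky_side n a b k"
    and ext: "f ` schottky_exterior n a b i = schottky_disc n a b k"
  shows "g ` schottky_side n a b k = schottky_side n a b i"
    and "g ` schottky_exterior n a b k = schottky_disc n a b i"
proof -
  have undo: "g ` f ` U = U" if "U \<subseteq> \<H>" for U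
    using g that by (force simp: image_image)
  have sideH: "schottky_side n a b i \<subseteq> \<H>" and extH: "schottky_exterior n a b i \<subseteq> \<H>"
    by (auto simp: schottky_side_def schottky_exterior_def)
  show "g ` schottky_side n a b k = schottky_side n a b i"
    using undo[OF sideH] side by simp
  have "f ` schottky_disc n a b i =
      f ` \<H> - f ` (schottky_side n a b i \<union> schottky_exterior n a b i)"
    unfolding schottky_disc_eq[of n a b i]
    using f sideH extH by (intro inj_on_image_set_diff[of f \<H>]) (auto simp: bij_betw_def)
  also have "\<dots> = schottky_exterior n a b k"
    using f side ext by (simp add: image_Un bij_betw_def schottky_exterior_eq)
  finally show "g ` schottky_exterior n a b k = schottky_disc n a b i"
    using undo[OF schottky_disc_subset] by metis
qed

theorem proposition3p1:
  fixes n :: nat and a b :: "nat \<Rightarrow> real"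
    and S :: "nat \<Rightarrow> (real^2^2) set" and \<Gamma> :: "(real^2^2) set set"
  assumes "n \<ge> 2"
    and "fuchsian_schottky_group n a b S \<Gamma>"
  shows "\<forall>j\<in>{1..n}.
      (S j \<in> \<Gamma> \<and>
       hyp_isometry (psl_act (S j)) \<and>
       orientation_preserving_on \<H> (psl_act (S j)) \<and>
       side_pairing n a b j (j + n) (psl_act (S j))) \<and>
      (inv\<^bsub>PSL2R\<^esub> (S j) \<in> \<Gamma> \<and>
       hyp_isometry (psl_act (inv\<^bsub>PSL2R\<^esub> (S j))) \<and>
       orientation_preserving_on \<H> (psl_act (inv\<^bsub>PSL2R\<^esub> (S j))) \<and>
       side_pairing n a b (j + n) j (psl_act (inv\<^bsub>PSL2R\<^esub> (S j))))"
proof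
  fix j assume j: "j \<in> {1..n}"
  have disj: "\<forall>i\<in>{1..2*n}. \<forall>k\<in>{1..2*n}. i \<noteq> k \<longrightarrow>
      closure (schottky_disc n a b i) \<inter> closure (schottky_disc n a b k) = {}"
    and carrier: "S j \<in> carrier PSL2R"
    and side: "psl_act (S j) ` schottky_side n a b j = schottky_side n a b (j + n)"
    and ext: "psl_act (S j) ` schottky_exterior n a b j = schottky_disc n a b (j + n)"
    and \<Gamma>: "\<Gamma> = generate PSL2R (S ` {1..n})"
    using assms(2) j unfolding fuchsian_schottky_group_def by blast+
  have ind: "j \<in> {1..2*n}" "j + n \<in> {1..2*n}"
    using j by auto
  obtain A B where A: "det A = 1" and B: "det B = 1" and AB: "A ** B = mat 1"
    and BA: "B ** A = mat 1"
    and act: "psl_act (S j) = moebius_mat A" "psl_act (inv\<^bsub>PSL2R\<^esub> (S j)) = moebius_mat B"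
    using PSL2R_act_representatives[OF carrier] by blast
  note inverse = inverse_pairs_sides[OF bij_betw_moebius[OF A B AB] moebius_mat_inverse[OF A BA]
      side[unfolded act] ext[unfolded act]]
  have "S j \<in> \<Gamma>" "inv\<^bsub>PSL2R\<^esub> (S j) \<in> \<Gamma>"
    using j unfolding \<Gamma> by (auto intro: generate.incl generate.inv)
  then show "(S j \<in> \<Gamma> \<and>
       hyp_isometry (psl_act (S j)) \<and>
       orientation_preserving_on \<H> (psl_act (S j)) \<and>
       side_pairing n a b j (j + n) (psl_act (S j))) \<and>
      (inv\<^bsub>PSL2R\<^esub> (S j) \<in> \<Gamma> \<and>
       hyp_isometry (psl_act (inv\<^bsub>PSL2R\<^esub> (S j))) \<and>
       orientation_preserving_on \<H> (psl_act (inv\<^bsub>PSL2R\<^esub> (S j))) \<and>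
       side_pairing n a b (j + n) j (psl_act (inv\<^bsub>PSL2R\<^esub> (S j))))"
    using hyp_isometry_moebius[OF A B AB] hyp_isometry_moebius[OF B A BA]
      orientation_preserving_moebius[OF A] orientation_preserving_moebius[OF B]
      side_pairingI[OF disj ind side ext] side_pairingI[OF disj ind(2,1) inverse]
    by (simp add: act)
qed

end
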